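(* As $m \to + \infty$, $$\mathsf{D}^{(3)} (\mathcal{B}^{(2)}_m) \sim \frac{3 \sqrt{3}}{2} m^2,$$ i.e. the ratio of the two sides tends to $1$.
   Context: A sequence over a subset $X$ of an abelian group is a finite unordered sequence (multiset) of elements of $X$; its length is the number of terms (with multiplicity) and its support is the set of distinct elements occurring in it. It is a minimal zero-sum sequence if its terms sum to $0$ and no non-empty proper subsequence sums to $0$. For a positive integer $k$, $\mathsf{D}^{(k)}(X)$ denotes the largest length of a minimal zero-sum sequence over $X$ whose support has exactly $k$ elements. For positive integers $d,m$, $\mathcal{B}^{(d)}_m=\{(u_1,\dots,u_d)\in\mathbb{Z}^d : u_1^2+\cdots+u_d^2\le m^2\}\subseteq \mathbb{Z}^d$. *)

theory Defs
  imports
    "HOL-Analysis.Analysis"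
    "HOL-Library.Multiset"
    "HOL-Library.Landau_Symbols"
begin

definition minimal_zero_sum :: "'a::ab_group_add multiset \<Rightarrow> bool" where
  "minimal_zero_sum S \<longleftrightarrow>
     sum_mset S = 0 \<and> (\<forall>T. T \<noteq> {#} \<and> T \<subset># S \<longrightarrow> sum_mset T \<noteq> 0)"

(* The value is only meaningful when the set of lengths is finite and non-empty;
   otherwise Max is unspecified. For finite X the set of lengths is always finite. *)
definition davenport_supp :: "nat \<Rightarrow> 'a::ab_group_add set \<Rightarrow> nat" where
  "davenport_supp k X =
     Max {size S | S. set_mset S \<subseteq> X \<and> card (set_mset S) = k \<and> minimal_zero_sum S}"

(* The dimension d is the cardinality of the index type 'd. *)
definition int_ball :: "nat \<Rightarrow> (int ^ 'd) set" where
  "int_ball m = {u. (\<Sum>i\<in>UNIV. (u $ i)\<^sup>2) \<le> (int m)\<^sup>2}"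

end

theory Submission
  imports Defs "HOL-Real_Asymp.Real_Asymp"
begin

text \<open>
  Let \<open>a, b, c\<close> be the support of a minimal zero-sum sequence over the ball. If the three vectors
  span the plane, their relations are the multiples of \<open>(det b c, det c a, det a b)\<close>, and
  minimality bounds the multiplicities by the absolute values of these determinants, whose sum is
  twice the area of the triangle \<open>a, b, c\<close>. A triangle in a disc of radius \<open>m\<close> has area at most
  \<open>3 * sqrt 3 / 4 * m\<^sup>2\<close> by Weitzenboeck's inequality. If the vectors are collinear, the length is at
  most \<open>m\<^sup>2 + 4 * m\<close>, which is smaller.

  For the lower bound take \<open>a = (2k + 1, 1)\<close>, \<open>b = (-k, h)\<close>, \<open>c = (-k, -h)\<close>
  with \<open>k = j\<^sup>2\<close>, \<open>j\<close> even, and \<open>h = j * \<lfloor>sqrt 3 * j\<rfloor> + 1\<close>. This triangle is nearly equilateral, and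
  two of its determinants are coprime because \<open>h\<close> is coprime to \<open>j\<close>. Hence the determinants are the
  multiplicities of a minimal zero-sum sequence.
\<close>

section \<open>Multisets on three elements and their relations\<close>

definition triple_mset :: "'a \<Rightarrow> 'a \<Rightarrow> 'a \<Rightarrow> nat \<Rightarrow> nat \<Rightarrow> nat \<Rightarrow> 'a multiset" where
  "triple_mset a b c x y z = replicate_mset x a + replicate_mset y b + replicate_mset z c"

definition is_relation :: "int ^ 2 \<Rightarrow> int ^ 2 \<Rightarrow> int ^ 2 \<Rightarrow> nat \<Rightarrow> nat \<Rightarrow> nat \<Rightarrow> bool" where
  "is_relation a b c x y z \<longleftrightarrow> (\<forall>i. int x * a $ i + int y * b $ i + int z * c $ i = 0)"

text \<open>The determinant of two plane vectors. Its cyclic sum over \<open>a\<close>,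
  \<open>b\<close>, \<open>c\<close> is twice the signed area of the triangle.\<close>

definition cross :: "int ^ 2 \<Rightarrow> int ^ 2 \<Rightarrow> int" where
  "cross a b = a $ 1 * b $ 2 - a $ 2 * b $ 1"

lemma size_triple_mset [simp]: "size (triple_mset a b c x y z) = x + y + z"
  by (simp add: triple_mset_def)

lemma sum_mset_replicate_mset_nth:
  fixes a :: "int ^ 'n"
  shows "sum_mset (replicate_mset n a) $ i = int n * a $ i"
  by (induction n) (simp_all add: algebra_simps)

lemma sum_triple_mset_eq_0_iff:
  "sum_mset (triple_mset a b c x y z) = 0 \<longleftrightarrow> is_relation a b c x y z"
  by (simp add: triple_mset_def is_relation_def vec_eq_iff sum_mset_replicate_mset_nth
      del: sum_mset_replicate_mset)

lemma card_3_multiset: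
  assumes "card (set_mset S) = 3"
  obtains a b c x y z where "distinct [a, b, c]" "x > 0" "y > 0" "z > 0"
    "set_mset S = {a, b, c}" "S = triple_mset a b c x y z"
proof -
  obtain a b c where abc: "set_mset S = {a, b, c}" "a \<noteq> b" "a \<noteq> c" "b \<noteq> c"
    using assms by (auto simp: card_3_iff)
  have "S = triple_mset a b c (count S a) (count S b) (count S c)"
    using abc by (intro multiset_eqI) (auto simp: triple_mset_def count_eq_zero_iff)
  moreover have "count S a > 0" "count S b > 0" "count S c > 0"
    using abc(1) by auto
  ultimately show thesis
    using abc that[of a b c "count S a" "count S b" "count S c"] by simp
qed

text \<open>Since \<open>a\<close>, \<open>b\<close>, \<open>c\<close> are distinct, submultisets
  correspond to triples of multiplicities below \<open>(x, y, z)\<close>. Minimality thus says that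
  this box contains no relations other than its two extreme corners.\<close>

lemma minimal_triple_mset_iff:
  assumes "distinct [a, b, c]"
  shows "minimal_zero_sum (triple_mset a b c x y z) \<longleftrightarrow>
    is_relation a b c x y z \<and>
    (\<forall>x' y' z'. x' \<le> x \<longrightarrow> y' \<le> y \<longrightarrow> z' \<le> z \<longrightarrow> is_relation a b c x' y' z' \<longrightarrow>
       (x', y', z') = (0, 0, 0) \<or> (x', y', z') = (x, y, z))"
    (is "?L \<longleftrightarrow> ?R")
proof
  have sub: "triple_mset a b c x' y' z' \<subseteq># triple_mset a b c x y z"
    if "x' \<le> x" "y' \<le> y" "z' \<le> z" for x' y' z'
    using that assms by (auto simp: subseteq_mset_def triple_mset_def)
  have inj: "(x', y', z') = (u, v, w)"
    if "triple_mset a b c x' y' z' = triple_mset a b c u v w" for x' y' z' u v w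
    using arg_cong[OF that, of "\<lambda>S. count S a"] arg_cong[OF that, of "\<lambda>S. count S b"]
      arg_cong[OF that, of "\<lambda>S. count S c"] assms
    by (auto simp: triple_mset_def)
  have empty: "triple_mset a b c 0 0 0 = {#}"
    by (simp add: triple_mset_def)
  show ?R if ?L
  proof (intro conjI allI impI)
    show "is_relation a b c x y z"
      using that by (simp add: minimal_zero_sum_def sum_triple_mset_eq_0_iff)
    fix x' y' z' assume *: "x' \<le> x" "y' \<le> y" "z' \<le> z" "is_relation a b c x' y' z'"
    let ?T = "triple_mset a b c x' y' z'"
    have "?T = {#} \<or> ?T = triple_mset a b c x y z"
      using that sub[OF *(1-3)] *(4)
      by (auto simp: minimal_zero_sum_def subset_mset_def simp flip: sum_triple_mset_eq_0_iff)
    then show "(x', y', z') = (0, 0, 0) \<or> (x', y', z') = (x, y, z)"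
      using inj[of x' y' z' 0 0 0] inj[of x' y' z' x y z] unfolding empty by auto
  qed
  show ?L if R: ?R
    unfolding minimal_zero_sum_def
  proof (intro conjI allI impI)
    show "sum_mset (triple_mset a b c x y z) = 0"
      using R by (simp add: sum_triple_mset_eq_0_iff)
    fix T assume T: "T \<noteq> {#} \<and> T \<subset># triple_mset a b c x y z"
    have le: "count T u \<le> count (triple_mset a b c x y z) u" for u
      using T by (simp add: mset_subset_eq_count subset_mset_def)
    have eq: "T = triple_mset a b c (count T a) (count T b) (count T c)"
    proof (rule multiset_eqI)
      fix u show "count T u = count (triple_mset a b c (count T a) (count T b) (count T c)) u"
        using le[of u] assms by (auto simp: triple_mset_def)
    qed
    have "count T a \<le> x" "count T b \<le> y" "count T c \<le> z"
      using le[of a] le[of b] le[of c] assms by (auto simp: triple_mset_def)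
    then show "sum_mset T \<noteq> 0"
      using R T eq empty sum_triple_mset_eq_0_iff[of a b c "count T a" "count T b" "count T c"]
      by (metis Pair_inject subset_mset.less_irrefl)
  qed
qed

section \<open>Determinants and multiplicities\<close>

text \<open>Pairing the relation with \<open>a\<close>, \<open>b\<close> and \<open>c\<close> under
  \<open>cross\<close> eliminates one vector each time. So the multiplicities and the three
  determinants are linearly dependent triples.\<close>

lemma is_relation_cross:
  assumes "is_relation a b c x y z"
  shows "int y * cross a b = int z * cross c a" "int x * cross a b = int z * cross b c"
    "int x * cross c a = int y * cross b c"
proof -
  have 1: "int x * a $ 1 + int y * b $ 1 + int z * c $ 1 = 0"
    and 2: "int x * a $ 2 + int y * b $ 2 + int z * c $ 2 = 0"
    using assms by (auto simp: is_relation_def)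
  show "int y * cross a b = int z * cross c a" unfolding cross_def using 1 2 by algebra
  show "int x * cross a b = int z * cross b c" unfolding cross_def using 1 2 by algebra
  show "int x * cross c a = int y * cross b c" unfolding cross_def using 1 2 by algebra
qed

text \<open>Expansion of the 3 by 3 determinant with columns \<open>a\<close>, \<open>b\<close>,
  \<open>c\<close> in which row \<open>i\<close> occurs twice.\<close>

lemma cross_identity:
  "cross b c * a $ i + cross c a * b $ i + cross a b * c $ i = 0"
  using exhaust_2[of i] by (auto simp: cross_def algebra_simps)

text \<open>The sign \<open>s\<close> corrects the orientation of the triangle, so that the
  determinants can serve as multiplicities.\<close>

lemma is_relation_nat_cross:
  assumes "s = 1 \<or> s = -1" "s * cross b c \<ge> 0" "s * cross c a \<ge> 0" "s * cross a b \<ge> 0"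
  shows "is_relation a b c (nat (s * cross b c)) (nat (s * cross c a)) (nat (s * cross a b))"
  unfolding is_relation_def
proof
  fix i
  have "s * (cross b c * a $ i + cross c a * b $ i + cross a b * c $ i) = 0"
    by (simp add: cross_identity)
  then show "int (nat (s * cross b c)) * a $ i + int (nat (s * cross c a)) * b $ i
      + int (nat (s * cross a b)) * c $ i = 0"
    using assms by (simp add: algebra_simps)
qed

text \<open>A relation is a rational multiple of the determinants, and coprimality makes the factor
  an integer: \<open>cross b c\<close> divides \<open>x\<close>. Hence \<open>x\<close> is an end of
  its range, and it fixes \<open>y\<close> and \<open>z\<close>.\<close>

lemma coprime_cross_imp_minimal:
  assumes "distinct [a, b, c]" "cross b c > 0" "cross c a > 0" "cross a b > 0"
    and cop: "coprime (cross b c) (cross c a)"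
  shows "minimal_zero_sum
    (triple_mset a b c (nat (cross b c)) (nat (cross c a)) (nat (cross a b)))"
  unfolding minimal_triple_mset_iff[OF assms(1)]
proof (intro conjI allI impI)
  show "is_relation a b c (nat (cross b c)) (nat (cross c a)) (nat (cross a b))"
    using is_relation_nat_cross[of 1 b c a] assms by simp
  fix x y z
  assume le: "x \<le> nat (cross b c)" "y \<le> nat (cross c a)" "z \<le> nat (cross a b)"
    and rel: "is_relation a b c x y z"
  note eqs = is_relation_cross[OF rel]
  have "cross b c dvd int x * cross c a" by (simp add: eqs(3))
  with cop have "cross b c dvd int x" by (simp add: coprime_dvd_mult_left_iff)
  then have "x = 0 \<or> int x = cross b c"
    using le(1) assms(2) zdvd_imp_le[of "cross b c" "int x"] by fastforce
  then show "(x, y, z) = (0, 0, 0) \<or>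
      (x, y, z) = (nat (cross b c), nat (cross c a), nat (cross a b))"
  proof
    assume "x = 0" with eqs assms show ?thesis by auto
  next
    assume "int x = cross b c" with eqs assms have "int y = cross c a" "int z = cross a b" by auto
    with \<open>int x = cross b c\<close> show ?thesis by (metis nat_int)
  qed
qed

text \<open>If the length exceeded the sum of the determinants, proportionality would make each
  multiplicity exceed its determinant. The determinants would then form a smaller non-zero
  relation.\<close>

lemma minimal_size_le_cross:
  assumes "distinct [a, b, c]" "x > 0" "y > 0" "z > 0"
    and min: "minimal_zero_sum (triple_mset a b c x y z)"
    and nz: "cross b c \<noteq> 0 \<or> cross c a \<noteq> 0 \<or> cross a b \<noteq> 0"
  shows "int (x + y + z) \<le> \<bar>cross b c + cross c a + cross a b\<bar>"
proof -
  let ?p = "cross b c" and ?q = "cross c a" and ?r = "cross a b"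
  have rel: "is_relation a b c x y z"
    using min by (simp add: minimal_triple_mset_iff[OF assms(1)])
  note eqs = is_relation_cross[OF rel]
  \<comment> \<open>As \<open>x\<close>, \<open>y\<close>, \<open>z\<close> are positive, the three
    determinants are all non-zero and share one sign, namely \<open>s\<close>.\<close>
  define s where "s = sgn ?p"
  have p0: "?p \<noteq> 0" using eqs nz assms(2-4) by auto
  then have s: "s = 1 \<or> s = -1" by (auto simp: s_def sgn_if)
  have sp: "s * ?p > 0" using p0 by (auto simp: s_def sgn_if)
  have eqs': "int y * (s * ?r) = int z * (s * ?q)" "int x * (s * ?r) = int z * (s * ?p)"
    "int x * (s * ?q) = int y * (s * ?p)"
    using eqs by (simp_all add: mult.left_commute)
  have "int x * (s * ?q) > 0" unfolding eqs'(3) using sp assms by simp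
  then have sq: "s * ?q > 0" using assms by (simp add: zero_less_mult_iff)
  have "int x * (s * ?r) > 0" unfolding eqs'(2) using sp assms by simp
  then have sr: "s * ?r > 0" using assms by (simp add: zero_less_mult_iff)
  have abs: "\<bar>?p + ?q + ?r\<bar> = s * ?p + s * ?q + s * ?r"
    using s sp sq sr by auto
  show ?thesis
  proof (rule ccontr)
    assume contr: "\<not> ?thesis"
    let ?P = "s * ?p" and ?Q = "s * ?q" and ?R = "s * ?r"
    have "int x > ?P"
    proof (rule ccontr)
      assume "\<not> int x > ?P"
      then have x: "int x \<le> ?P" by simp
      have "int y * ?P \<le> ?Q * ?P"
        using mult_right_mono[OF x, of ?Q] eqs'(3) sq by (simp add: mult.commute)
      moreover have "int z * ?P \<le> ?R * ?P"
        using mult_right_mono[OF x, of ?R] eqs'(2) sr by (simp add: mult.commute)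
      ultimately have "int y \<le> ?Q" "int z \<le> ?R"
        using mult_right_le_imp_le[OF _ sp] by blast+
      with x contr abs show False by simp
    qed
    then have x: "?P < int x" .
    have "?Q * ?P < int y * ?P"
      using mult_strict_right_mono[OF x sq] eqs'(3) by (simp add: mult.commute)
    moreover have "?R * ?P < int z * ?P"
      using mult_strict_right_mono[OF x sr] eqs'(2) by (simp add: mult.commute)
    ultimately have y: "?Q < int y" and z: "?R < int z"
      using mult_right_less_imp_less[OF _ less_imp_le[OF sp]] by blast+
    have "is_relation a b c (nat ?P) (nat ?Q) (nat ?R)"
      using is_relation_nat_cross[OF s] sp sq sr by simp
    moreover have "nat ?P < x" "nat ?Q < y" "nat ?R < z"
      using x y z sp sq sr by (simp_all only: nat_less_iff less_imp_le)
    moreover have "nat ?P > 0" using sp by (simp only: zero_less_nat_eq)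
    ultimately show False
      using min unfolding minimal_triple_mset_iff[OF assms(1)]
      by (metis less_irrefl less_imp_le Pair_inject)
  qed
qed

section \<open>The largest triangle in a disc\<close>

text \<open>
  The proof is Weitzenboeck's inequality: \<open>w - v\<close> minus the rotation by 60 degrees of \<open>u - v\<close> has
  non-negative square norm.
\<close>

lemma triangle_in_disc_area_le:
  fixes a1 a2 b1 b2 c1 c2 m :: real
  assumes "a1\<^sup>2 + a2\<^sup>2 \<le> m\<^sup>2" "b1\<^sup>2 + b2\<^sup>2 \<le> m\<^sup>2" "c1\<^sup>2 + c2\<^sup>2 \<le> m\<^sup>2"
  shows "(b1 * c2 - b2 * c1) + (c1 * a2 - c2 * a1) + (a1 * b2 - a2 * b1) \<le> 3 * sqrt 3 / 2 * m\<^sup>2"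
proof -
  define t where "t = sqrt (3::real)"
  have t: "t * t = 3" "t > 0" by (auto simp: t_def)
  define D where
    "D = (b1 * c2 - b2 * c1) + (c1 * a2 - c2 * a1) + (a1 * b2 - a2 * b1)"
  define u1 u2 v1 v2 where uv: "u1 = b1 - a1" "u2 = b2 - a2" "v1 = c1 - a1" "v2 = c2 - a2"
  have D: "D = u1 * v2 - u2 * v1" by (simp add: D_def uv algebra_simps)
  have "0 \<le> (v1 - (u1 - t * u2) / 2)\<^sup>2 + (v2 - (t * u1 + u2) / 2)\<^sup>2" by simp
  also have "\<dots> = v1\<^sup>2 + v2\<^sup>2 + (1 + t * t) / 4 * (u1\<^sup>2 + u2\<^sup>2) - (u1 * v1 + u2 * v2) - t * D"
    unfolding D by (simp add: power2_eq_square field_simps)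
  also have "\<dots> = v1\<^sup>2 + v2\<^sup>2 + u1\<^sup>2 + u2\<^sup>2 - (u1 * v1 + u2 * v2) - t * D"
    by (simp add: t)
  finally have "0 \<le> v1\<^sup>2 + v2\<^sup>2 + u1\<^sup>2 + u2\<^sup>2 - (u1 * v1 + u2 * v2) - t * D" .
  \<comment> \<open>Both sides are the sum of the squared side lengths. Omitting the square of
    \<open>a + b + c\<close> on the right leaves at most \<open>9 * m^2\<close> plus
    \<open>9 * m^2\<close>, halved by the factor 2.\<close>
  moreover have "2 * (v1\<^sup>2 + v2\<^sup>2 + u1\<^sup>2 + u2\<^sup>2 - (u1 * v1 + u2 * v2)) =
      3 * (a1\<^sup>2 + a2\<^sup>2) + 3 * (b1\<^sup>2 + b2\<^sup>2) + 3 * (c1\<^sup>2 + c2\<^sup>2)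
      - ((a1 + b1 + c1)\<^sup>2 + (a2 + b2 + c2)\<^sup>2)"
    by (simp add: uv power2_eq_square algebra_simps)
  moreover have "(a1 + b1 + c1)\<^sup>2 + (a2 + b2 + c2)\<^sup>2 \<ge> 0" by simp
  ultimately have "2 * (t * D) \<le> 9 * m\<^sup>2" using assms by argo
  then have "t * (2 * (t * D)) \<le> t * (9 * m\<^sup>2)" using t by (intro mult_left_mono) auto
  also have "t * (2 * (t * D)) = 2 * (t * t) * D" by simp
  also have "\<dots> = 6 * D" by (simp add: t)
  finally show ?thesis by (simp add: D_def t_def)
qed

lemma int_ball_2_iff: "(u :: int ^ 2) \<in> int_ball m \<longleftrightarrow> (u $ 1)\<^sup>2 + (u $ 2)\<^sup>2 \<le> (int m)\<^sup>2"
  by (simp add: int_ball_def sum_2)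

lemma cross_sum_le:
  assumes "a \<in> int_ball m" "b \<in> int_ball m" "c \<in> int_ball m"
  shows "real_of_int \<bar>cross b c + cross c a + cross a b\<bar> \<le> 3 * sqrt 3 / 2 * (real m)\<^sup>2"
proof -
  have ball: "(real_of_int (u $ 1))\<^sup>2 + (real_of_int (u $ 2))\<^sup>2 \<le> (real m)\<^sup>2"
    if "u \<in> int_ball m" for u :: "int ^ 2"
  proof -
    have "real_of_int ((u $ 1)\<^sup>2 + (u $ 2)\<^sup>2) \<le> real_of_int ((int m)\<^sup>2)"
      using that unfolding int_ball_2_iff of_int_le_iff .
    then show ?thesis by simp
  qed
  have le: "real_of_int (cross v w + cross w u + cross u v) \<le> 3 * sqrt 3 / 2 * (real m)\<^sup>2"
    if "u \<in> int_ball m" "v \<in> int_ball m" "w \<in> int_ball m" for u v w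
    using triangle_in_disc_area_le[OF that[THEN ball]] by (simp add: cross_def)
  \<comment> \<open>Exchanging \<open>b\<close> and \<open>c\<close> reverses the orientation, which
    turns the bound into one for the absolute value.\<close>
  have "cross c b + cross b a + cross a c = - (cross b c + cross c a + cross a b)"
    by (simp add: cross_def)
  with le[OF assms] le[OF assms(1,3,2)] show ?thesis by linarith
qed

section \<open>Collinear supports\<close>

text \<open>If \<open>x \<le> m\<close>, then \<open>y + z \<le> x * a \<le> m * m\<close>.
  Otherwise \<open>x\<close> exceeds \<open>b\<close> and \<open>c\<close>, so the excluded pairs
  force \<open>y < a\<close> and \<open>z < a\<close>, and then
  \<open>x \<le> 2 * m\<close>.\<close>

lemma one_against_two_bound:
  fixes a b c x y z m :: nat
  assumes "x * a = y * b + z * c" "0 < a" "0 < b" "0 < c" "a \<le> m" "b \<le> m" "c \<le> m"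
    and "\<not> (b \<le> x \<and> a \<le> y)" "\<not> (c \<le> x \<and> a \<le> z)"
  shows "x + y + z \<le> m\<^sup>2 + 4 * m"
proof (cases "x \<le> m")
  case True
  have "y + z \<le> y * b + z * c" using assms by (intro add_mono) auto
  also have "\<dots> \<le> m * m" using assms True by (metis mult_le_mono)
  finally show ?thesis using True by (simp add: power2_eq_square)
next
  case False
  then have y: "y < a" and z: "z < a" using assms by auto
  have "x * a \<le> a * m + a * m"
    unfolding assms(1) using y z assms by (intro add_mono mult_le_mono) auto
  also have "\<dots> = (2 * m) * a" by simp
  finally have "x \<le> 2 * m" using \<open>0 < a\<close> by (simp only: mult_le_cancel2)
  then show ?thesis using y z assms by simp
qed

text \<open>A vanishing positive combination has terms of both signs, so one of \<open>a\<close>,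
  \<open>b\<close>, \<open>c\<close> stands alone against the other two. The three choices are
  cyclic copies of the one-against-two case.\<close>

lemma signed_relation_bound:
  fixes a b c :: int and x y z m :: nat
  assumes rel: "int x * a + int y * b + int z * c = 0"
    and pos: "x > 0" "y > 0" "z > 0" and nz: "a \<noteq> 0" "b \<noteq> 0" "c \<noteq> 0"
    and le: "\<bar>a\<bar> \<le> int m" "\<bar>b\<bar> \<le> int m" "\<bar>c\<bar> \<le> int m"
    and ab: "a * b < 0 \<Longrightarrow> \<not> (nat \<bar>b\<bar> \<le> x \<and> nat \<bar>a\<bar> \<le> y)"
    and bc: "b * c < 0 \<Longrightarrow> \<not> (nat \<bar>c\<bar> \<le> y \<and> nat \<bar>b\<bar> \<le> z)"
    and ca: "c * a < 0 \<Longrightarrow> \<not> (nat \<bar>a\<bar> \<le> z \<and> nat \<bar>c\<bar> \<le> x)"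
  shows "x + y + z \<le> m\<^sup>2 + 4 * m"
proof -
  let ?a = "nat \<bar>a\<bar>" and ?b = "nat \<bar>b\<bar>" and ?c = "nat \<bar>c\<bar>"
  have bounds: "0 < ?a" "0 < ?b" "0 < ?c" "?a \<le> m" "?b \<le> m" "?c \<le> m"
    using nz le by auto
  have eq: "u * nat \<bar>d\<bar> = v * nat \<bar>e\<bar> + w * nat \<bar>f\<bar>"
    if "int u * d + int v * e + int w * f = 0" "d * e < 0" "f * d < 0" for u v w d e f
  proof -
    have "d > 0 \<and> e < 0 \<and> f < 0 \<or> d < 0 \<and> e > 0 \<and> f > 0"
      using that(2,3) unfolding mult_less_0_iff by linarith
    then have "int u * \<bar>d\<bar> = int v * \<bar>e\<bar> + int w * \<bar>f\<bar>"
      using that(1) by (smt (verit) mult_minus_right)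
    then have "int (u * nat \<bar>d\<bar>) = int (v * nat \<bar>e\<bar> + w * nat \<bar>f\<bar>)" by simp
    then show ?thesis unfolding of_nat_eq_iff .
  qed
  have not_same: "\<not> (a > 0 \<and> b > 0 \<and> c > 0)" "\<not> (a < 0 \<and> b < 0 \<and> c < 0)"
  proof -
    show "\<not> (a > 0 \<and> b > 0 \<and> c > 0)"
    proof
      assume "a > 0 \<and> b > 0 \<and> c > 0"
      then have "int x * a > 0" "int y * b > 0" "int z * c > 0" using pos by simp_all
      with rel show False by simp
    qed
    show "\<not> (a < 0 \<and> b < 0 \<and> c < 0)"
    proof
      assume "a < 0 \<and> b < 0 \<and> c < 0"
      then have "int x * a < 0" "int y * b < 0" "int z * c < 0"
        using pos by (simp_all add: mult_pos_neg)
      with rel show False by simp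
    qed
  qed
  have "a * b < 0 \<and> c * a < 0 \<or> a * b < 0 \<and> b * c < 0 \<or> b * c < 0 \<and> c * a < 0"
    using not_same nz[unfolded neq_iff]
    by (elim disjE) (simp_all add: mult_pos_neg mult_neg_pos)
  then consider "a * b < 0" "c * a < 0" | "a * b < 0" "b * c < 0" | "b * c < 0" "c * a < 0"
    by blast
  then show ?thesis
  proof cases
    case 1
    then have "x * ?a = y * ?b + z * ?c" using eq rel by blast
    from one_against_two_bound[OF this bounds ab[OF 1(1)]] ca[OF 1(2)] show ?thesis
      by (simp only: conj_commute simp_thms)
  next
    case 2
    then have "y * ?b = z * ?c + x * ?a" using eq[of y b z c x a] rel by simp
    from one_against_two_bound[OF this bounds(2,3,1,5,6,4) bc[OF 2(2)]] ab[OF 2(1)] show ?thesis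
      by (simp only: conj_commute add_ac simp_thms)
  next
    case 3
    then have "z * ?c = x * ?a + y * ?b" using eq[of z c x a y b] rel by simp
    from one_against_two_bound[OF this bounds(3,1,2,6,4,5) ca[OF 3(2)]] bc[OF 3(1)] show ?thesis
      by (simp only: conj_commute add_ac simp_thms)
  qed
qed

text \<open>On a line, a coordinate \<open>i\<close> that is non-zero at \<open>a\<close> determines
  the vectors, which reduces the problem to integers. Two oppositely directed vectors satisfy a
  relation with third multiplicity 0, so minimality forbids it to fit.\<close>

lemma collinear_size_le:
  assumes "distinct [a, b, c]" "x > 0" "y > 0" "z > 0"
    and ball: "a \<in> int_ball m" "b \<in> int_ball m" "c \<in> int_ball m"
    and min: "minimal_zero_sum (triple_mset a b c x y z)"
    and collinear: "cross b c = 0" "cross c a = 0" "cross a b = 0"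
  shows "x + y + z \<le> m\<^sup>2 + 4 * m"
proof -
  have rel: "is_relation a b c x y z"
    using min by (simp add: minimal_triple_mset_iff[OF assms(1)])
  have minD: "(x', y', z') = (0, 0, 0) \<or> (x', y', z') = (x, y, z)"
      if "x' \<le> x" "y' \<le> y" "z' \<le> z" "is_relation a b c x' y' z'" for x' y' z'
    using min that unfolding minimal_triple_mset_iff[OF assms(1)] by blast
  \<comment> \<open>A zero vector would be a proper zero-sum subsequence of length one.\<close>
  have nz0: "a \<noteq> 0" "b \<noteq> 0" "c \<noteq> 0"
    using minD[of 1 0 0] minD[of 0 1 0] minD[of 0 0 1] assms(2-4) by (auto simp: is_relation_def)
  have cross0: "u $ k * v $ l = u $ l * v $ k" if "cross u v = 0" for u v k l
    using that exhaust_2[of k] exhaust_2[of l] by (auto simp: cross_def mult.commute)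
  obtain i where i: "a $ i \<noteq> 0"
    using \<open>a \<noteq> 0\<close> by (auto simp: vec_eq_iff)
  have "v $ i \<noteq> 0" if "cross a v = 0" "v \<noteq> 0" for v
  proof
    assume "v $ i = 0"
    then have "v $ k = 0" for k using cross0[OF that(1), of i k] i by simp
    with that(2) show False by (simp add: vec_eq_iff)
  qed
  moreover have "cross a c = - cross c a" by (simp add: cross_def)
  ultimately have nz: "b $ i \<noteq> 0" "c $ i \<noteq> 0" using nz0 collinear by simp_all
  have le: "\<bar>u $ i\<bar> \<le> int m" if "u \<in> int_ball m" for u :: "int ^ 2"
  proof -
    have "(u $ i)\<^sup>2 \<le> (int m)\<^sup>2"
      using that exhaust_2[of i] unfolding int_ball_2_iff
      by (smt (verit) zero_le_power2)
    then show ?thesis by (simp add: abs_le_square_iff[symmetric])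
  qed
  have vanish: "int (nat \<bar>v $ i\<bar>) * u $ k + int (nat \<bar>u $ i\<bar>) * v $ k = 0"
    if "u $ i * v $ i < 0" "cross u v = 0" for u v k
    using that(1) cross0[OF that(2), of i k] by (auto simp: mult_less_0_iff mult.commute)
  show ?thesis
  proof (rule signed_relation_bound[of x "a $ i" y "b $ i" z "c $ i"])
    show "int x * a $ i + int y * b $ i + int z * c $ i = 0"
      using rel by (simp add: is_relation_def)
    show "\<not> (nat \<bar>b $ i\<bar> \<le> x \<and> nat \<bar>a $ i\<bar> \<le> y)" if s: "a $ i * b $ i < 0"
    proof
      assume le: "nat \<bar>b $ i\<bar> \<le> x \<and> nat \<bar>a $ i\<bar> \<le> y"
      have "is_relation a b c (nat \<bar>b $ i\<bar>) (nat \<bar>a $ i\<bar>) 0"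
        using vanish[OF s collinear(3)] by (simp add: is_relation_def add.commute)
      with minD[of "nat \<bar>b $ i\<bar>" "nat \<bar>a $ i\<bar>" 0] le i nz assms(2-4)
      show False by auto
    qed
    show "\<not> (nat \<bar>c $ i\<bar> \<le> y \<and> nat \<bar>b $ i\<bar> \<le> z)" if s: "b $ i * c $ i < 0"
    proof
      assume le: "nat \<bar>c $ i\<bar> \<le> y \<and> nat \<bar>b $ i\<bar> \<le> z"
      have "is_relation a b c 0 (nat \<bar>c $ i\<bar>) (nat \<bar>b $ i\<bar>)"
        using vanish[OF s collinear(1)] by (simp add: is_relation_def add.commute)
      with minD[of 0 "nat \<bar>c $ i\<bar>" "nat \<bar>b $ i\<bar>"] le i nz assms(2-4)
      show False by auto
    qed
    show "\<not> (nat \<bar>a $ i\<bar> \<le> z \<and> nat \<bar>c $ i\<bar> \<le> x)" if s: "c $ i * a $ i < 0"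
    proof
      assume le: "nat \<bar>a $ i\<bar> \<le> z \<and> nat \<bar>c $ i\<bar> \<le> x"
      have "is_relation a b c (nat \<bar>c $ i\<bar>) 0 (nat \<bar>a $ i\<bar>)"
        using vanish[OF s collinear(2)] by (simp add: is_relation_def add.commute)
      with minD[of "nat \<bar>c $ i\<bar>" 0 "nat \<bar>a $ i\<bar>"] le i nz assms(2-4)
      show False by auto
    qed
  qed (use assms(2-4) i nz le ball in simp_all)
qed

section \<open>The upper bound\<close>

lemma minimal_size_le:
  assumes "m \<ge> 4" "set_mset S \<subseteq> (int_ball m :: (int ^ 2) set)" "card (set_mset S) = 3"
    and "minimal_zero_sum S"
  shows "real (size S) \<le> 3 * sqrt 3 / 2 * (real m)\<^sup>2"
proof -
  obtain a b c x y z where S: "distinct [a, b, c]" "x > 0" "y > 0" "z > 0"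
    "set_mset S = {a, b, c}" "S = triple_mset a b c x y z"
    using card_3_multiset[OF assms(3)] by blast
  have ball: "a \<in> int_ball m" "b \<in> int_ball m" "c \<in> int_ball m"
    using S(5) assms(2) by auto
  have min: "minimal_zero_sum (triple_mset a b c x y z)" using S assms by simp
  show ?thesis
  proof (cases "cross b c = 0 \<and> cross c a = 0 \<and> cross a b = 0")
    case True
    have "size S \<le> m\<^sup>2 + 4 * m"
      using collinear_size_le[OF S(1-4) ball min] True S(6) by simp
    also have "\<dots> \<le> 2 * m\<^sup>2" using assms(1) by (simp add: power2_eq_square)
    finally have "real (size S) \<le> real (2 * m\<^sup>2)" by (simp only: of_nat_le_iff)
    then have "real (size S) \<le> 2 * (real m)\<^sup>2" by simp
    also have "\<dots> \<le> 3 * sqrt 3 / 2 * (real m)\<^sup>2"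
    proof (rule mult_right_mono)
      \<comment> \<open>\<open>16/9\<close> is the square of \<open>4/3\<close>, and
        \<open>3 * (4/3) / 2 = 2\<close>.\<close>
      have "sqrt (16/9) \<le> sqrt (3::real)" by (rule real_sqrt_le_mono) simp
      then show "2 \<le> 3 * sqrt 3 / (2::real)" by (simp add: real_sqrt_divide)
    qed simp
    finally show ?thesis .
  next
    case False
    then have "int (size S) \<le> \<bar>cross b c + cross c a + cross a b\<bar>"
      using minimal_size_le_cross[OF S(1-4) min] S(6) by auto
    then have "real (size S) \<le> real_of_int \<bar>cross b c + cross c a + cross a b\<bar>"
      by linarith
    also have "\<dots> \<le> 3 * sqrt 3 / 2 * (real m)\<^sup>2" by (rule cross_sum_le[OF ball])
    finally show ?thesis .
  qed
qed

section \<open>A nearly equilateral triangle with coprime determinants\<close>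

text \<open>The choice of \<open>h\<close> makes it 1 modulo \<open>j\<close>, hence coprime to
  \<open>k\<close>, yet within \<open>j\<close> of \<open>sqrt 3 * k\<close>. The hypothesis on
  \<open>m\<close> leaves room for vertices of norm up to \<open>2 * k + 2\<close>.\<close>

lemma exists_long_minimal:
  fixes j :: int
  assumes "even j" "j > 0" "2 * j\<^sup>2 + 2 \<le> int m"
  shows "\<exists>S. set_mset S \<subseteq> (int_ball m :: (int ^ 2) set) \<and> card (set_mset S) = 3 \<and>
    minimal_zero_sum S \<and> real (size S) \<ge> 6 * (real_of_int j)^3 * (sqrt 3 * real_of_int j - 1)"
proof -
  define i where "i = \<lfloor>sqrt 3 * real_of_int j\<rfloor>"
  define k where "k = j\<^sup>2"
  define h where "h = j * i + 1"
  have "1 * real_of_int j \<le> sqrt 3 * real_of_int j"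
    using assms by (intro mult_right_mono) auto
  then have ij: "i \<ge> j" by (simp add: i_def le_floor_iff)
  have i_sq: "i\<^sup>2 \<le> 3 * j\<^sup>2"
  proof -
    have "real_of_int i \<le> sqrt 3 * real_of_int j" by (simp add: i_def)
    then have "(real_of_int i)\<^sup>2 \<le> (sqrt 3 * real_of_int j)\<^sup>2"
      using ij assms by (intro power_mono) auto
    then have "real_of_int (i\<^sup>2) \<le> real_of_int (3 * j\<^sup>2)" by (simp add: power_mult_distrib)
    then show ?thesis unfolding of_int_le_iff .
  qed
  have k: "k > 0" and ji: "j * i \<ge> k" using assms ij by (auto simp: k_def power2_eq_square)
  then have h: "h > k" by (simp add: h_def)
  have even_k: "even k" and odd_h: "odd h" using assms by (auto simp: k_def h_def)
  have "i \<le> 2 * j"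
  proof (rule power2_le_imp_le)
    have "(2 * j)\<^sup>2 = 4 * j\<^sup>2" by (simp add: power_mult_distrib)
    then show "i\<^sup>2 \<le> (2 * j)\<^sup>2" using i_sq zero_le_power2[of j] by linarith
  qed (use assms in simp)
  then have "j * i \<le> j * (2 * j)" using assms by (intro mult_left_mono) auto
  then have ji2: "j * i \<le> 2 * k" by (simp add: k_def power2_eq_square)
  have "k * i\<^sup>2 \<le> k * (3 * j\<^sup>2)" using k i_sq by (intro mult_left_mono) auto
  then have "(j * i)\<^sup>2 \<le> 3 * k\<^sup>2" by (simp add: k_def power2_eq_square algebra_simps)
  \<comment> \<open>The squares contribute at most \<open>4 * k^2\<close>; the rest,
    \<open>2 * j * i + 1 \<le> 4 * k + 1\<close>, is absorbed by \<open>8 * k + 4\<close>.\<close>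
  then have "k\<^sup>2 + h\<^sup>2 \<le> (2 * k + 2)\<^sup>2"
    using ji2 k by (simp add: h_def power2_eq_square algebra_simps)
  also have m2: "(2 * k + 2)\<^sup>2 \<le> (int m)\<^sup>2"
    using assms k by (intro power_mono) (auto simp: k_def)
  finally have bc_ball: "k\<^sup>2 + h\<^sup>2 \<le> (int m)\<^sup>2" .
  have "(2 * k + 1)\<^sup>2 + 1 \<le> (2 * k + 2)\<^sup>2" using k by (simp add: power2_eq_square algebra_simps)
  with m2 have a_ball: "(2 * k + 1)\<^sup>2 + 1 \<le> (int m)\<^sup>2" by simp
  \<comment> \<open>Both offsets in \<open>a\<close> serve coprimality: with
    \<open>(2 * k + 1, 0)\<close> the factor \<open>h\<close>, and with \<open>(2 * k, 1)\<close>
    the factor \<open>k\<close>, would divide both \<open>cross b c\<close> and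
    \<open>cross c a\<close>.\<close>
  define a b c :: "int ^ 2" where
    abc: "a = vector [2 * k + 1, 1]" "b = vector [-k, h]" "c = vector [-k, -h]"
  have p: "cross b c = 2 * k * h" and q: "cross c a = (2 * k + 1) * h - k"
    and r: "cross a b = (2 * k + 1) * h + k"
    by (simp_all add: cross_def abc algebra_simps)
  have dist: "distinct [a, b, c]"
    using k h by (auto simp: abc vec_eq_iff forall_2)
  have "h \<le> (2 * k + 1) * h" using k h by simp
  then have pos: "cross b c > 0" "cross c a > 0" "cross a b > 0"
    unfolding p q r using k h by (simp, linarith, linarith)
  have "coprime j h"
  proof (rule coprimeI)
    fix d assume d: "d dvd j" "d dvd h"
    then have "d dvd h - j * i" by (intro dvd_diff dvd_mult2)
    then show "is_unit d" by (simp add: h_def)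
  qed
  then have kh: "coprime k h" by (simp add: k_def)
  \<comment> \<open>The factors \<open>k\<close>, \<open>h\<close>, 2 of \<open>cross b c\<close>
    are treated separately: \<open>cross c a\<close> is \<open>h\<close> modulo \<open>k\<close>,
    \<open>-k\<close> modulo \<open>h\<close>, and odd.\<close>
  have "coprime k (cross c a)"
  proof (rule coprimeI)
    fix d assume d: "d dvd k" "d dvd cross c a"
    then have "d dvd cross c a - (2 * h - 1) * k" by (intro dvd_diff dvd_mult)
    also have "cross c a - (2 * h - 1) * k = h" unfolding q by (simp add: algebra_simps)
    finally show "is_unit d" using kh d(1) by (blast intro: coprime_common_divisor)
  qed
  moreover have "coprime h (cross c a)"
  proof (rule coprimeI)
    fix d assume d: "d dvd h" "d dvd cross c a"
    then have "d dvd (2 * k + 1) * h - cross c a" by (intro dvd_diff dvd_mult)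
    also have "(2 * k + 1) * h - cross c a = k" unfolding q by simp
    finally show "is_unit d" using kh d(1) by (blast intro: coprime_common_divisor)
  qed
  moreover have "coprime 2 (cross c a)"
    unfolding q using even_k odd_h by simp
  ultimately have cop: "coprime (cross b c) (cross c a)"
    unfolding p by (simp only: coprime_mult_left_iff)
  define S where "S = triple_mset a b c (nat (cross b c)) (nat (cross c a)) (nat (cross a b))"
  have min: "minimal_zero_sum S"
    unfolding S_def by (rule coprime_cross_imp_minimal[OF dist pos cop])
  have set: "set_mset S = {a, b, c}" using pos by (auto simp: S_def triple_mset_def)
  have ball: "{a, b, c} \<subseteq> int_ball m"
    using a_ball bc_ball by (auto simp: int_ball_2_iff abc)
  have "int (size S) = 2 * h * (3 * k + 1)"
    using pos by (simp add: S_def p q r algebra_simps)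
  then have "real_of_int (int (size S)) = real_of_int (2 * h * (3 * k + 1))" by (simp only:)
  then have size: "real (size S) = 2 * real_of_int h * (3 * real_of_int k + 1)" by simp
  let ?j = "real_of_int j"
  have h_ge: "real_of_int h \<ge> ?j * (sqrt 3 * ?j - 1)"
  proof -
    have "sqrt 3 * ?j - 1 \<le> real_of_int i" unfolding i_def by linarith
    then have "?j * (sqrt 3 * ?j - 1) \<le> ?j * real_of_int i"
      using assms by (intro mult_left_mono) auto
    then show ?thesis by (simp add: h_def)
  qed
  have "6 * ?j ^ 3 * (sqrt 3 * ?j - 1) = 6 * real_of_int k * (?j * (sqrt 3 * ?j - 1))"
    by (simp add: k_def power2_eq_square power3_eq_cube algebra_simps)
  also have "\<dots> \<le> 6 * real_of_int k * real_of_int h"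
    using h_ge k by (intro mult_left_mono) auto
  also have "\<dots> \<le> real (size S)"
    unfolding size using h k by (simp add: algebra_simps)
  finally show ?thesis
    using min set ball dist by (intro exI[of _ S]) auto
qed

section \<open>Two-sided bounds and the asymptotics\<close>

text \<open>The largest even \<open>j\<close> with \<open>2 * j^2 + 2 \<le> m\<close> is
  \<open>2 * \<lfloor>s\<rfloor>\<close> for \<open>s = sqrt ((m - 2) / 8)\<close>. Replacing the
  floor by \<open>s - 1\<close> gives the closed form \<open>g\<close>, fit for asymptotic
  analysis.\<close>

lemma davenport_supp_bounds:
  fixes m :: nat
  defines "g \<equiv> 2 * (sqrt ((real m - 2) / 8) - 1)"
  assumes m: "m \<ge> 40"
  shows "6 * g ^ 3 * (sqrt 3 * g - 1) \<le> real (davenport_supp 3 (int_ball m :: (int ^ 2) set))"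
    and "real (davenport_supp 3 (int_ball m :: (int ^ 2) set)) \<le> 3 * sqrt 3 / 2 * (real m)\<^sup>2"
proof -
  define L where "L = {size S | S. set_mset S \<subseteq> (int_ball m :: (int ^ 2) set) \<and>
    card (set_mset S) = 3 \<and> minimal_zero_sum S}"
  have upper: "real n \<le> 3 * sqrt 3 / 2 * (real m)\<^sup>2" if "n \<in> L" for n
    using that minimal_size_le[of m] m by (auto simp: L_def)
  \<comment> \<open>The length bound itself yields finiteness; with the sequence constructed below,
    \<open>Max L\<close> is meaningful.\<close>
  have fin: "finite L"
  proof (rule finite_subset)
    show "L \<subseteq> {..nat \<lfloor>3 * sqrt 3 / 2 * (real m)\<^sup>2\<rfloor>}"
      using upper by (auto simp: le_nat_floor)
  qed simp
  have D: "davenport_supp 3 (int_ball m :: (int ^ 2) set) = Max L"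
    by (simp add: davenport_supp_def L_def)
  define s where "s = sqrt ((real m - 2) / 8)"
  define j where "j = 2 * \<lfloor>s\<rfloor>"
  have "sqrt 4 \<le> s" unfolding s_def using m by (intro real_sqrt_le_mono) auto
  then have s: "s \<ge> 2" by simp
  have g_s: "g = 2 * (s - 1)" by (simp add: g_def s_def)
  have g: "g \<ge> 2" using s by (simp add: g_s)
  have "s - 1 \<le> real_of_int \<lfloor>s\<rfloor>" by linarith
  then have "2 * (s - 1) \<le> 2 * real_of_int \<lfloor>s\<rfloor>" by (rule mult_left_mono) simp
  then have g_le: "g \<le> real_of_int j" unfolding g_s j_def of_int_mult of_int_numeral .
  have "(real_of_int j)\<^sup>2 \<le> (2 * s)\<^sup>2"
    using s by (intro power_mono) (auto simp: j_def)
  also have "\<dots> = (real m - 2) / 2" using m by (simp add: power_mult_distrib s_def)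
  finally have "real_of_int (2 * j\<^sup>2 + 2) \<le> real_of_int (int m)" by simp
  then have "2 * j\<^sup>2 + 2 \<le> int m" unfolding of_int_le_iff .
  moreover have "even j" by (simp add: j_def)
  moreover have "j > 0" using g g_le by linarith
  ultimately obtain S :: "(int ^ 2) multiset" where S:
    "set_mset S \<subseteq> int_ball m" "card (set_mset S) = 3" "minimal_zero_sum S"
    "6 * (real_of_int j) ^ 3 * (sqrt 3 * real_of_int j - 1) \<le> real (size S)"
    using exists_long_minimal[of j m] by blast
  then have "size S \<in> L" unfolding L_def by blast
  \<comment> \<open>Monotonicity of the product needs the last factor to be non-negative.\<close>
  have "1 * 1 \<le> sqrt 3 * g" using g by (intro mult_mono) auto
  then have "6 * g ^ 3 * (sqrt 3 * g - 1) \<le> 6 * (real_of_int j) ^ 3 * (sqrt 3 * real_of_int j - 1)"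
    using g g_le by (intro mult_mono power_mono diff_right_mono) auto
  also note S(4)
  also have "real (size S) \<le> real (Max L)" using Max_ge[OF fin \<open>size S \<in> L\<close>] by simp
  finally show "6 * g ^ 3 * (sqrt 3 * g - 1) \<le>
      real (davenport_supp 3 (int_ball m :: (int ^ 2) set))" by (simp add: D)
  show "real (davenport_supp 3 (int_ball m :: (int ^ 2) set)) \<le> 3 * sqrt 3 / 2 * (real m)\<^sup>2"
    unfolding D using \<open>size S \<in> L\<close> fin by (intro upper Max_in) auto
qed

theorem theorem2:
  "(\<lambda>m::nat. real (davenport_supp 3 (int_ball m :: (int ^ 2) set)))
     \<sim>[at_top] (\<lambda>m. 3 * sqrt 3 / 2 * (real m)\<^sup>2)"
proof (rule asymp_equiv_sandwich_real)
  let ?g = "\<lambda>m::nat. 2 * (sqrt ((real m - 2) / 8) - 1)"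
  show "(\<lambda>m. 6 * ?g m ^ 3 * (sqrt 3 * ?g m - 1)) \<sim>[at_top] (\<lambda>m. 3 * sqrt 3 / 2 * (real m)\<^sup>2)"
  proof -
    let ?s = "\<lambda>m::nat. sqrt ((real m - 2) / 8)"
    \<comment> \<open>The leading term is \<open>6 * (2 * s)^3 * sqrt 3 * 2 * s\<close>. Writing
      \<open>s^4\<close> as \<open>(s^2)^2\<close> lets \<open>s^2 = (m - 2) / 8\<close> be
      inserted, and \<open>96 / 64 = 3 / 2\<close>.\<close>
    have "(\<lambda>s. 6 * (2 * (s - 1)) ^ 3 * (sqrt 3 * (2 * (s - 1)) - 1))
        \<sim>[at_top] (\<lambda>s. 96 * sqrt 3 * (s ^ 2) ^ 2)"
      by real_asymp
    moreover have "filterlim ?s at_top at_top" by real_asymp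
    ultimately have "(\<lambda>m. 6 * ?g m ^ 3 * (sqrt 3 * ?g m - 1))
        \<sim>[at_top] (\<lambda>m. 96 * sqrt 3 * (?s m ^ 2) ^ 2)"
      by (rule asymp_equiv_compose')
    also have "\<forall>\<^sub>F m in at_top. 96 * sqrt 3 * (?s m ^ 2) ^ 2 = 3 * sqrt 3 / 2 * (real m - 2)\<^sup>2"
      using eventually_ge_at_top[of "2::nat"] by eventually_elim (simp add: power_divide)
    also have "(\<lambda>m::nat. 3 * sqrt 3 / 2 * (real m - 2)\<^sup>2)
        \<sim>[at_top] (\<lambda>m. 3 * sqrt 3 / 2 * (real m)\<^sup>2)"
      by (intro asymp_equiv_mult asymp_equiv_power asymp_equiv_refl) real_asymp
    finally show ?thesis .
  qed
  show "(\<lambda>m::nat. 3 * sqrt 3 / 2 * (real m)\<^sup>2) \<sim>[at_top] (\<lambda>m. 3 * sqrt 3 / 2 * (real m)\<^sup>2)"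
    by (rule asymp_equiv_refl)
  show "\<forall>\<^sub>F m in at_top. real (davenport_supp 3 (int_ball m :: (int ^ 2) set))
      \<in> {6 * ?g m ^ 3 * (sqrt 3 * ?g m - 1)..3 * sqrt 3 / 2 * (real m)\<^sup>2}"
    using eventually_ge_at_top[of "40::nat"]
    by eventually_elim (use davenport_supp_bounds in auto)
qed

end
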